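(* Let $X$ be a compact metric space, let $\varphi:\mathbb{R}^+_0\times X\to X$ be a continuous semiflow, and let $\tau$ be an admissible function on $X$ (for the semiflow $\varphi$, with respect to some subset $Z\subset X$). Then $h^\tau_{\mathrm{top}}(\varphi)=h_{\mathrm{top}}(\varphi)$.
   Context: A semiflow on $X$ is a map $\psi:\mathbb{R}^+_0\times X\to X$, written $\psi_t(x)=\psi(t,x)$, with $\psi_0=\mathrm{id}$ and $\psi_{t+s}=\psi_t\circ\psi_s$ for all $s,t\ge 0$. Admissible functions. Let $\psi$ be a (not necessarily continuous) semiflow on a metric space $X$. Let $\tau$ assign to each $x\in X$ a strictly increasing (possibly finite, possibly empty) sequence $(\tau_n(x))_{n\in A(x)}$ of positive real numbers, where $A(x)=\{1,\dots,\ell\}$ for some $\ell\ge 0$ or $A(x)=\mathbb{N}=\{1,2,\dots\}$. For $Z\subset X$, $\tau$ is admissible with respect to $Z$ if there is $\eta>0$ such that $\tau_1(x)\ge\eta$ for all $x\in Z$ with $A(x)\neq\emptyset$, and for all $x\in X$: (1) for every $s\ge 0$ the sequence $\tau(\psi_s(x))$ is the increasing enumeration of $\{\tau_n(x)-s: n\in A(x),\ \tau_n(x)>s\}$; (2) $\tau_{n+1}(x)-\tau_n(x)\ge\eta$ whenever $n,n+1\in A(x)$. $\tau$-topological entropy. For $x\in X$, $T>0$, $0<\delta<\eta/2$ put $$J^\tau_{T,\delta}(x)=(0,T]\setminus\bigcup_{j\in A(x),\ \tau_j(x)\le T}\,(\tau_j(x)-\delta,\tau_j(x)+\delta),$$ and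 for $\epsilon>0$ put $B^\tau(x,\psi,T,\epsilon,\delta)=\{y\in X:\operatorname{dist}(\psi_t(x),\psi_t(y))<\epsilon\ \ \forall t\in J^\tau_{T,\delta}(x)\}$. A set $E\subseteq X$ is $(\psi,\tau,T,\epsilon,\delta)$-separated if for each $x\in E$ no $y\in E\setminus\{x\}$ lies in $B^\tau(x,\psi,T,\epsilon,\delta)$. Let $s^\tau(\psi,T,\epsilon,\delta)=\sup\{|E|: E \text{ finite and } (\psi,\tau,T,\epsilon,\delta)\text{-separated}\}$, $h^\tau(\psi,\epsilon,\delta)=\limsup_{T\to+\infty}\frac1T\log s^\tau(\psi,T,\epsilon,\delta)$ (with $\log\infty=\infty$), $h^\tau(\psi,\delta)=\lim_{\epsilon\to0^+}h^\tau(\psi,\epsilon,\delta)$ and $h^\tau_{\mathrm{top}}(\psi)=\lim_{\delta\to0^+}h^\tau(\psi,\delta)$; both limits exist by monotonicity. Classical topological entropy of a continuous semiflow $\varphi$ on a compact metric space: with $B(x,\varphi,T,\epsilon)=\{y:\operatorname{dist}(\varphi_t(x),\varphi_t(y))<\epsilon\ \forall t\in[0,T]\}$, a set $E$ is $(\varphi,T,\epsilon)$-separated if for each $x\in E$ the only point of $E$ in $B(x,\varphi,T,\epsilon)$ is $x$; $s(\varphi,T,\epsilon)$ is the maximal cardinality of such a set, and $h_{\mathrm{top}}(\varphi)=\lim_{\epsilon\to0^+}\limsup_{T\to+\infty}\frac1T\log s(\varphi,T,\epsilon)$. *)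

theory Defs
  imports "HOL-Analysis.Analysis"
begin

text \<open>The phase space is a subset \<open>X\<close> of a metric space type, with the induced metric. Maps on the
  phase space are total functions on the type, whose values outside \<open>X\<close> (and at negative
  times) are irrelevant.\<close>

definition semiflow :: "'a set \<Rightarrow> (real \<Rightarrow> 'a \<Rightarrow> 'a) \<Rightarrow> bool" where
  "semiflow X \<psi> \<longleftrightarrow>
     (\<forall>t\<ge>0. \<forall>x\<in>X. \<psi> t x \<in> X) \<and>
     (\<forall>x\<in>X. \<psi> 0 x = x) \<and>
     (\<forall>s\<ge>0. \<forall>t\<ge>0. \<forall>x\<in>X. \<psi> (t + s) x = \<psi> t (\<psi> s x))"

definition continuous_semiflow :: "'a::metric_space set \<Rightarrow> (real \<Rightarrow> 'a \<Rightarrow> 'a) \<Rightarrow> bool" where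
  "continuous_semiflow X \<psi> \<longleftrightarrow>
     semiflow X \<psi> \<and> continuous_on ({0..} \<times> X) (\<lambda>(t, x). \<psi> t x)"

text \<open>A possibly finite, possibly empty sequence is a pair of an index set \<open>I\<close>, either
  \<open>{1..l}\<close> (empty for \<open>l = 0\<close>) or all positive integers, and a function \<open>u\<close> whose values are
  relevant on \<open>I\<close> only.\<close>

definition index_set :: "nat set \<Rightarrow> bool" where
  "index_set I \<longleftrightarrow> (\<exists>l. I = {1..l}) \<or> I = {1..}"

definition increasing_enumeration :: "nat set \<Rightarrow> (nat \<Rightarrow> real) \<Rightarrow> real set \<Rightarrow> bool" where
  "increasing_enumeration I u S \<longleftrightarrow> index_set I \<and> strict_mono_on I u \<and> u ` I = S"

definition time_sequences :: "'a set \<Rightarrow> ('a \<Rightarrow> nat set) \<Rightarrow> ('a \<Rightarrow> nat \<Rightarrow> real) \<Rightarrow> bool" where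
  "time_sequences X A \<tau> \<longleftrightarrow>
     (\<forall>x\<in>X. index_set (A x) \<and> strict_mono_on (A x) (\<tau> x) \<and> (\<forall>n\<in>A x. \<tau> x n > 0))"

definition admissible ::
  "'a set \<Rightarrow> (real \<Rightarrow> 'a \<Rightarrow> 'a) \<Rightarrow> 'a set \<Rightarrow> ('a \<Rightarrow> nat set) \<Rightarrow> ('a \<Rightarrow> nat \<Rightarrow> real) \<Rightarrow> bool" where
  "admissible X \<psi> Z A \<tau> \<longleftrightarrow>
     time_sequences X A \<tau> \<and>
     (\<exists>\<eta>>0.
        (\<forall>x\<in>Z. A x \<noteq> {} \<longrightarrow> \<tau> x 1 \<ge> \<eta>) \<and>
        (\<forall>x\<in>X.
           (\<forall>s\<ge>0. increasing_enumeration (A (\<psi> s x)) (\<tau> (\<psi> s x))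
                      {\<tau> x n - s | n. n \<in> A x \<and> \<tau> x n > s}) \<and>
           (\<forall>n. n \<in> A x \<and> n + 1 \<in> A x \<longrightarrow> \<tau> x (n + 1) - \<tau> x n \<ge> \<eta>)))"

text \<open>Logarithm of a cardinality, with \<open>log 0 = -\<infinity>\<close> (relevant for empty \<open>X\<close> only) and
  \<open>log \<infinity> = \<infinity>\<close>.\<close>

definition ln_enat :: "enat \<Rightarrow> ereal" where
  "ln_enat n = (case n of enat k \<Rightarrow> if k = 0 then -\<infinity> else ereal (ln (real k)) | \<infinity> \<Rightarrow> \<infinity>)"

text \<open>In the \<open>\<tau>\<close>-entropy the parameter \<open>\<delta>\<close> is meant to satisfy \<open>\<delta> < \<eta>/2\<close> for the \<open>\<eta>\<close> of
  admissibility. The definitions below make sense for every \<open>\<delta>\<close>, and the bound is immaterial in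
  the final limit \<open>\<delta> \<rightarrow> 0+\<close>.\<close>

definition tau_times ::
  "('a \<Rightarrow> nat set) \<Rightarrow> ('a \<Rightarrow> nat \<Rightarrow> real) \<Rightarrow> real \<Rightarrow> real \<Rightarrow> 'a \<Rightarrow> real set" where
  "tau_times A \<tau> T \<delta> x =
     {0<..T} - (\<Union>j\<in>{j \<in> A x. \<tau> x j \<le> T}. {\<tau> x j - \<delta> <..< \<tau> x j + \<delta>})"

definition tau_ball ::
  "'a::metric_space set \<Rightarrow> ('a \<Rightarrow> nat set) \<Rightarrow> ('a \<Rightarrow> nat \<Rightarrow> real) \<Rightarrow> (real \<Rightarrow> 'a \<Rightarrow> 'a) \<Rightarrow>
     'a \<Rightarrow> real \<Rightarrow> real \<Rightarrow> real \<Rightarrow> 'a set" where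
  "tau_ball X A \<tau> \<psi> x T \<epsilon> \<delta> =
     {y \<in> X. \<forall>t \<in> tau_times A \<tau> T \<delta> x. dist (\<psi> t x) (\<psi> t y) < \<epsilon>}"

definition tau_separated ::
  "'a::metric_space set \<Rightarrow> ('a \<Rightarrow> nat set) \<Rightarrow> ('a \<Rightarrow> nat \<Rightarrow> real) \<Rightarrow> (real \<Rightarrow> 'a \<Rightarrow> 'a) \<Rightarrow>
     real \<Rightarrow> real \<Rightarrow> real \<Rightarrow> 'a set \<Rightarrow> bool" where
  "tau_separated X A \<tau> \<psi> T \<epsilon> \<delta> E \<longleftrightarrow>
     E \<subseteq> X \<and> (\<forall>x\<in>E. \<forall>y\<in>E - {x}. y \<notin> tau_ball X A \<tau> \<psi> x T \<epsilon> \<delta>)"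

definition tau_sep_number ::
  "'a::metric_space set \<Rightarrow> ('a \<Rightarrow> nat set) \<Rightarrow> ('a \<Rightarrow> nat \<Rightarrow> real) \<Rightarrow> (real \<Rightarrow> 'a \<Rightarrow> 'a) \<Rightarrow>
     real \<Rightarrow> real \<Rightarrow> real \<Rightarrow> enat" where
  "tau_sep_number X A \<tau> \<psi> T \<epsilon> \<delta> =
     (SUP E \<in> {E. finite E \<and> tau_separated X A \<tau> \<psi> T \<epsilon> \<delta> E}. enat (card E))"

definition tau_growth ::
  "'a::metric_space set \<Rightarrow> ('a \<Rightarrow> nat set) \<Rightarrow> ('a \<Rightarrow> nat \<Rightarrow> real) \<Rightarrow> (real \<Rightarrow> 'a \<Rightarrow> 'a) \<Rightarrow>
     real \<Rightarrow> real \<Rightarrow> ereal" where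
  "tau_growth X A \<tau> \<psi> \<epsilon> \<delta> =
     Limsup at_top (\<lambda>T. ereal (1 / T) * ln_enat (tau_sep_number X A \<tau> \<psi> T \<epsilon> \<delta>))"

definition tau_entropy_delta ::
  "'a::metric_space set \<Rightarrow> ('a \<Rightarrow> nat set) \<Rightarrow> ('a \<Rightarrow> nat \<Rightarrow> real) \<Rightarrow> (real \<Rightarrow> 'a \<Rightarrow> 'a) \<Rightarrow>
     real \<Rightarrow> ereal" where
  "tau_entropy_delta X A \<tau> \<psi> \<delta> = Lim (at_right 0) (\<lambda>\<epsilon>. tau_growth X A \<tau> \<psi> \<epsilon> \<delta>)"

definition tau_top_entropy ::
  "'a::metric_space set \<Rightarrow> ('a \<Rightarrow> nat set) \<Rightarrow> ('a \<Rightarrow> nat \<Rightarrow> real) \<Rightarrow> (real \<Rightarrow> 'a \<Rightarrow> 'a) \<Rightarrow>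
     ereal" where
  "tau_top_entropy X A \<tau> \<psi> = Lim (at_right 0) (\<lambda>\<delta>. tau_entropy_delta X A \<tau> \<psi> \<delta>)"

definition bowen_ball ::
  "'a::metric_space set \<Rightarrow> (real \<Rightarrow> 'a \<Rightarrow> 'a) \<Rightarrow> 'a \<Rightarrow> real \<Rightarrow> real \<Rightarrow> 'a set" where
  "bowen_ball X \<phi> x T \<epsilon> = {y \<in> X. \<forall>t\<in>{0..T}. dist (\<phi> t x) (\<phi> t y) < \<epsilon>}"

definition separated ::
  "'a::metric_space set \<Rightarrow> (real \<Rightarrow> 'a \<Rightarrow> 'a) \<Rightarrow> real \<Rightarrow> real \<Rightarrow> 'a set \<Rightarrow> bool" where
  "separated X \<phi> T \<epsilon> E \<longleftrightarrow> E \<subseteq> X \<and> (\<forall>x\<in>E. E \<inter> bowen_ball X \<phi> x T \<epsilon> = {x})"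

text \<open>For a continuous semiflow on a compact space, separated sets are finite of bounded
  cardinality, so this supremum is a maximum (lemma \<open>sep_number_attained\<close> below).\<close>

definition sep_number ::
  "'a::metric_space set \<Rightarrow> (real \<Rightarrow> 'a \<Rightarrow> 'a) \<Rightarrow> real \<Rightarrow> real \<Rightarrow> enat" where
  "sep_number X \<phi> T \<epsilon> = (SUP E \<in> {E. finite E \<and> separated X \<phi> T \<epsilon> E}. enat (card E))"

definition growth :: "'a::metric_space set \<Rightarrow> (real \<Rightarrow> 'a \<Rightarrow> 'a) \<Rightarrow> real \<Rightarrow> ereal" where
  "growth X \<phi> \<epsilon> = Limsup at_top (\<lambda>T. ereal (1 / T) * ln_enat (sep_number X \<phi> T \<epsilon>))"

definition top_entropy :: "'a::metric_space set \<Rightarrow> (real \<Rightarrow> 'a \<Rightarrow> 'a) \<Rightarrow> ereal" where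
  "top_entropy X \<phi> = Lim (at_right 0) (growth X \<phi>)"


text \<open>The limits in the definitions exist, so that \<open>Lim\<close> denotes them.\<close>

lemma ln_enat_mono: "m \<le> n \<Longrightarrow> ln_enat m \<le> ln_enat n"
  by (cases m; cases n) (auto simp: ln_enat_def)

lemma antimono_tendsto_at_right_0:
  fixes f :: "real \<Rightarrow> ereal"
  assumes "\<And>a b. 0 < a \<Longrightarrow> a \<le> b \<Longrightarrow> f b \<le> f a"
  shows "(f \<longlongrightarrow> (SUP a\<in>{0<..}. f a)) (at_right 0)"
proof (rule order_tendstoI)
  fix l assume "l < (SUP a\<in>{0<..}. f a)"
  then obtain a where a: "a > 0" "l < f a" by (auto simp: less_SUP_iff)
  show "eventually (\<lambda>x. l < f x) (at_right 0)"
    using eventually_at_right_real[OF a(1)]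
  proof eventually_elim
    case (elim x)
    then show ?case using assms[of x a] a by auto
  qed
next
  fix u assume u: "u > (SUP a\<in>{0<..}. f a)"
  show "eventually (\<lambda>x. f x < u) (at_right 0)"
    using eventually_at_right_real[OF zero_less_one]
  proof eventually_elim
    case (elim x)
    then have "f x \<le> (SUP a\<in>{0<..}. f a)" by (intro SUP_upper) auto
    then show ?case using u by auto
  qed
qed

lemma growth_rate_mono:
  assumes "\<And>T. m T \<le> n T"
  shows "Limsup at_top (\<lambda>T. ereal (1 / T) * ln_enat (m T))
           \<le> Limsup at_top (\<lambda>T. ereal (1 / T) * ln_enat (n T))"
proof (rule Limsup_mono)
  show "\<forall>\<^sub>F T in at_top. ereal (1 / T) * ln_enat (m T) \<le> ereal (1 / T) * ln_enat (n T)"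
    using eventually_gt_at_top[of 0]
  proof eventually_elim
    case (elim T)
    then show ?case by (intro ereal_mult_left_mono ln_enat_mono assms) simp
  qed
qed

lemma tau_growth_antimono:
  assumes "\<epsilon> \<le> \<epsilon>'" "\<delta> \<le> \<delta>'"
  shows "tau_growth X A \<tau> \<psi> \<epsilon>' \<delta>' \<le> tau_growth X A \<tau> \<psi> \<epsilon> \<delta>"
  unfolding tau_growth_def
proof (rule growth_rate_mono)
  fix T
  have "tau_ball X A \<tau> \<psi> x T \<epsilon> \<delta> \<subseteq> tau_ball X A \<tau> \<psi> x T \<epsilon>' \<delta>'" for x
  proof -
    have "{\<tau> x j - \<delta> <..< \<tau> x j + \<delta>} \<subseteq> {\<tau> x j - \<delta>' <..< \<tau> x j + \<delta>'}" for j
      using assms(2) by auto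
    then have "tau_times A \<tau> T \<delta>' x \<subseteq> tau_times A \<tau> T \<delta> x"
      unfolding tau_times_def by blast
    then show ?thesis
      using assms(1) unfolding tau_ball_def by (auto intro: order_less_le_trans)
  qed
  then have "tau_separated X A \<tau> \<psi> T \<epsilon>' \<delta>' E \<Longrightarrow> tau_separated X A \<tau> \<psi> T \<epsilon> \<delta> E" for E
    unfolding tau_separated_def by blast
  then show "tau_sep_number X A \<tau> \<psi> T \<epsilon>' \<delta>' \<le> tau_sep_number X A \<tau> \<psi> T \<epsilon> \<delta>"
    unfolding tau_sep_number_def by (intro SUP_subset_mono) auto
qed

lemma growth_antimono:
  assumes "0 < \<epsilon>" "\<epsilon> \<le> \<epsilon>'"
  shows "growth X \<phi> \<epsilon>' \<le> growth X \<phi> \<epsilon>"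
  unfolding growth_def
proof (rule growth_rate_mono)
  fix T
  have "bowen_ball X \<phi> x T \<epsilon> \<subseteq> bowen_ball X \<phi> x T \<epsilon>'" for x
    using assms unfolding bowen_ball_def by fastforce
  moreover have "x \<in> X \<Longrightarrow> x \<in> bowen_ball X \<phi> x T \<epsilon>" for x
    using assms unfolding bowen_ball_def by simp
  ultimately have "separated X \<phi> T \<epsilon>' E \<Longrightarrow> separated X \<phi> T \<epsilon> E" for E
    unfolding separated_def by blast
  then show "sep_number X \<phi> T \<epsilon>' \<le> sep_number X \<phi> T \<epsilon>"
    unfolding sep_number_def by (intro SUP_subset_mono) auto
qed

lemma tendsto_tau_entropy_delta:
  "((\<lambda>\<epsilon>. tau_growth X A \<tau> \<psi> \<epsilon> \<delta>) \<longlongrightarrow> tau_entropy_delta X A \<tau> \<psi> \<delta>) (at_right 0)"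
  and tau_entropy_delta_eq_SUP:
  "tau_entropy_delta X A \<tau> \<psi> \<delta> = (SUP \<epsilon>\<in>{0<..}. tau_growth X A \<tau> \<psi> \<epsilon> \<delta>)"
proof -
  have *: "((\<lambda>\<epsilon>. tau_growth X A \<tau> \<psi> \<epsilon> \<delta>) \<longlongrightarrow> (SUP \<epsilon>\<in>{0<..}. tau_growth X A \<tau> \<psi> \<epsilon> \<delta>)) (at_right 0)"
    by (intro antimono_tendsto_at_right_0 tau_growth_antimono) auto
  then show eq: "tau_entropy_delta X A \<tau> \<psi> \<delta> = (SUP \<epsilon>\<in>{0<..}. tau_growth X A \<tau> \<psi> \<epsilon> \<delta>)"
    unfolding tau_entropy_delta_def by (intro tendsto_Lim) auto
  show "((\<lambda>\<epsilon>. tau_growth X A \<tau> \<psi> \<epsilon> \<delta>) \<longlongrightarrow> tau_entropy_delta X A \<tau> \<psi> \<delta>) (at_right 0)"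
    using * eq by simp
qed

lemma tendsto_tau_top_entropy:
  "(tau_entropy_delta X A \<tau> \<psi> \<longlongrightarrow> tau_top_entropy X A \<tau> \<psi>) (at_right 0)"
proof -
  have *: "(tau_entropy_delta X A \<tau> \<psi> \<longlongrightarrow> (SUP \<delta>\<in>{0<..}. tau_entropy_delta X A \<tau> \<psi> \<delta>)) (at_right 0)"
    unfolding tau_entropy_delta_eq_SUP
    by (intro antimono_tendsto_at_right_0 SUP_mono) (auto intro: tau_growth_antimono)
  then have "tau_top_entropy X A \<tau> \<psi> = (SUP \<delta>\<in>{0<..}. tau_entropy_delta X A \<tau> \<psi> \<delta>)"
    unfolding tau_top_entropy_def by (intro tendsto_Lim) auto
  with * show ?thesis by simp
qed

lemma tendsto_top_entropy:
  "(growth X \<phi> \<longlongrightarrow> top_entropy X \<phi>) (at_right 0)"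
proof -
  have *: "(growth X \<phi> \<longlongrightarrow> (SUP \<epsilon>\<in>{0<..}. growth X \<phi> \<epsilon>)) (at_right 0)"
    by (intro antimono_tendsto_at_right_0 growth_antimono)
  then have "top_entropy X \<phi> = (SUP \<epsilon>\<in>{0<..}. growth X \<phi> \<epsilon>)"
    unfolding top_entropy_def by (intro tendsto_Lim) auto
  with * show ?thesis by simp
qed

lemma separated_bounded:
  assumes X: "compact X" and \<phi>: "continuous_semiflow X \<phi>" and "0 < \<epsilon>"
  obtains N where "\<And>E. separated X \<phi> T \<epsilon> E \<Longrightarrow> finite E \<and> card E \<le> N"
proof -
  have "continuous_on ({0..T} \<times> X) (\<lambda>(t, x). \<phi> t x)"
    using \<phi> unfolding continuous_semiflow_def by (auto intro: continuous_on_subset)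
  then have "uniformly_continuous_on ({0..T} \<times> X) (\<lambda>(t, x). \<phi> t x)"
    by (rule compact_uniformly_continuous) (intro compact_Times X compact_Icc)
  then obtain d where "d > 0" and d0: "\<And>p q. p \<in> {0..T} \<times> X \<Longrightarrow> q \<in> {0..T} \<times> X \<Longrightarrow> dist q p < d
      \<Longrightarrow> dist (case q of (t, x) \<Rightarrow> \<phi> t x) (case p of (t, x) \<Rightarrow> \<phi> t x) < \<epsilon>"
    by (rule uniformly_continuous_onE[OF _ \<open>0 < \<epsilon>\<close>]) blast
  have d: "dist (\<phi> t x) (\<phi> t y) < \<epsilon>"
    if "t \<in> {0..T}" "x \<in> X" "y \<in> X" "dist x y < d" for t x y
    using d0[of "(t, y)" "(t, x)"] that by (simp add: dist_Pair_Pair)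
  obtain K where K: "finite K" "X \<subseteq> (\<Union>k\<in>K. ball k (d / 2))"
    using X \<open>d > 0\<close> unfolding compact_eq_totally_bounded by (meson half_gt_zero)
  have "\<forall>x\<in>X. \<exists>k. k \<in> K \<and> x \<in> ball k (d / 2)" using K(2) by blast
  from bchoice[OF this] obtain c where c: "\<And>x. x \<in> X \<Longrightarrow> c x \<in> K \<and> x \<in> ball (c x) (d / 2)"
    by blast
  show thesis
  proof (rule that)
    fix E assume E: "separated X \<phi> T \<epsilon> E"
    have "inj_on c E"
    proof (rule inj_onI)
      fix x y assume xy: "x \<in> E" "y \<in> E" "c x = c y"
      then have X': "x \<in> X" "y \<in> X" using E by (auto simp: separated_def)
      have "dist x y < d"
        using c[OF X'(1)] c[OF X'(2)] xy(3) dist_triangle_half_r[of "c x" x d y] by simp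
      then have "y \<in> E \<inter> bowen_ball X \<phi> x T \<epsilon>"
        using X' xy d by (simp add: bowen_ball_def)
      then show "x = y" using E xy(1) by (auto simp: separated_def)
    qed
    moreover have "c ` E \<subseteq> K" using c E by (auto simp: separated_def)
    ultimately show "finite E \<and> card E \<le> card K"
      using K(1) by (meson card_inj_on_le inj_on_finite)
  qed
qed

lemma sep_number_attained:
  assumes "compact X" "continuous_semiflow X \<phi>" "0 < \<epsilon>"
  obtains E where "finite E" "separated X \<phi> T \<epsilon> E" "sep_number X \<phi> T \<epsilon> = enat (card E)"
    and "\<And>F. separated X \<phi> T \<epsilon> F \<Longrightarrow> finite F \<and> card F \<le> card E"
proof -
  obtain N where N: "\<And>E. separated X \<phi> T \<epsilon> E \<Longrightarrow> finite E \<and> card E \<le> N"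
    using separated_bounded[OF assms] by blast
  have "separated X \<phi> T \<epsilon> {}" by (simp add: separated_def)
  then obtain E where E: "separated X \<phi> T \<epsilon> E"
    and max: "\<And>F. separated X \<phi> T \<epsilon> F \<Longrightarrow> card F \<le> card E"
    using ex_has_greatest_nat[of "separated X \<phi> T \<epsilon>" "{}" card "Suc N"] N
    by (auto simp: less_Suc_eq_le)
  show thesis
  proof (rule that[OF _ E])
    show "sep_number X \<phi> T \<epsilon> = enat (card E)"
      unfolding sep_number_def using N E max
      by (intro antisym SUP_least SUP_upper) auto
  qed (use N E max in auto)
qed

end

theory Submission
  imports Defs
begin

text \<open>The excluded windows of length \<open>2\<delta>\<close> do not overlap, so the left end of a window with positive
  left end is itself an observed time, and by equicontinuity of \<open>\<phi> s\<close> for \<open>s \<in> [0, 1]\<close> closeness there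
  propagates through the window. Only a window around a \<open>\<tau> x 1 \<le> \<delta>\<close> has no such point; it
  lies in the initial time interval \<open>[0, 1]\<close>. There closeness is achieved by restricting to
  separated sets of small diameter, which costs a factor independent of \<open>T\<close> and hence no
  exponential growth.\<close>

text \<open>Joint continuity is uniform on the compact set \<open>{0..T} \<times> X\<close>;
  comparing two points with the same time coordinate yields one \<open>d\<close> for all
  \<open>t\<close>.\<close>

lemma semiflow_equicontinuous:
  assumes X: "compact X" and \<phi>: "continuous_semiflow X \<phi>" and "0 < \<epsilon>"
  obtains d where "0 < d"
    and "\<And>t x y. \<lbrakk>t \<in> {0..T}; x \<in> X; y \<in> X; dist x y < d\<rbrakk> \<Longrightarrow> dist (\<phi> t x) (\<phi> t y) < \<epsilon>"
proof -
  have "continuous_on ({0..T} \<times> X) (\<lambda>(t, x). \<phi> t x)"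
    using \<phi> unfolding continuous_semiflow_def by (auto intro: continuous_on_subset)
  then have "uniformly_continuous_on ({0..T} \<times> X) (\<lambda>(t, x). \<phi> t x)"
    by (rule compact_uniformly_continuous) (intro compact_Times X compact_Icc)
  then obtain d where "0 < d"
    and d: "\<And>p q. \<lbrakk>p \<in> {0..T} \<times> X; q \<in> {0..T} \<times> X; dist q p < d\<rbrakk>
      \<Longrightarrow> dist (case q of (t, x) \<Rightarrow> \<phi> t x) (case p of (t, x) \<Rightarrow> \<phi> t x) < \<epsilon>"
    by (rule uniformly_continuous_onE[OF _ \<open>0 < \<epsilon>\<close>]) blast
  show thesis
  proof
    show "dist (\<phi> t x) (\<phi> t y) < \<epsilon>" if "t \<in> {0..T}" "x \<in> X" "y \<in> X" "dist x y < d" for t x y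
      using d[of "(t, y)" "(t, x)"] that by (simp add: dist_Pair_Pair)
  qed fact
qed

text \<open>Index sets have no holes, so \<open>i + 1\<close> is an index; the gap after
  \<open>i\<close> then bounds all later differences by monotonicity.\<close>

lemma index_set_gap:
  assumes I: "index_set I" and mono: "strict_mono_on I u"
    and gap: "\<And>n. \<lbrakk>n \<in> I; n + 1 \<in> I\<rbrakk> \<Longrightarrow> u (n + 1) - u n \<ge> (\<eta>::real)"
    and ij: "i \<in> I" "j \<in> I" "i < j"
  shows "u j - u i \<ge> \<eta>"
proof -
  have I': "i + 1 \<in> I"
    using I ij by (auto simp: index_set_def)
  have "u (i + 1) \<le> u j"
    using strict_mono_onD[OF mono I' ij(2)] ij(3) by (cases "i + 1 = j") auto
  then show ?thesis
    using gap[OF ij(1) I'] by simp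
qed

text \<open>Earlier windows end at or before \<open>\<tau> x j - \<delta>\<close>, later ones start
  after it, and the \<open>j\<close>-th omits it, being open. The condition
  \<open>\<delta> < \<tau> x j\<close> makes the point positive.\<close>

lemma window_left_end_in_tau_times:
  assumes gap: "\<And>i j. \<lbrakk>i \<in> A x; j \<in> A x; i < j\<rbrakk> \<Longrightarrow> \<tau> x j - \<tau> x i \<ge> \<eta>"
    and \<delta>: "0 < \<delta>" "2 * \<delta> \<le> \<eta>"
    and j: "j \<in> A x" "\<tau> x j \<le> T" "\<delta> < \<tau> x j"
  shows "\<tau> x j - \<delta> \<in> tau_times A \<tau> T \<delta> x"
proof -
  have "\<tau> x j - \<delta> \<notin> {\<tau> x i - \<delta> <..< \<tau> x i + \<delta>}" if "i \<in> A x" for i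
    using gap[of i j] gap[of j i] that j(1) \<delta> by (cases i j rule: linorder_cases) auto
  then show ?thesis
    using j \<delta> unfolding tau_times_def by auto
qed

text \<open>Every time in \<open>{0..T}\<close> lies at most one time unit after an instant at which
  the orbits are \<open>d\<close>-close: time 0 or an observed time.\<close>

lemma tau_ball_subset_bowen_ball:
  assumes flow: "semiflow X \<phi>"
    and gap: "\<And>i j. \<lbrakk>i \<in> A x; j \<in> A x; i < j\<rbrakk> \<Longrightarrow> \<tau> x j - \<tau> x i \<ge> \<eta>"
    and \<delta>: "0 < \<delta>" "2 * \<delta> \<le> \<eta>" "2 * \<delta> \<le> 1"
    and equi: "\<And>t x y. \<lbrakk>t \<in> {0..1}; x \<in> X; y \<in> X; dist x y < d\<rbrakk> \<Longrightarrow> dist (\<phi> t x) (\<phi> t y) < \<epsilon>"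
    and x: "x \<in> X"
  shows "tau_ball X A \<tau> \<phi> x T d \<delta> \<inter> ball x d \<subseteq> bowen_ball X \<phi> x T \<epsilon>"
proof
  fix y assume "y \<in> tau_ball X A \<tau> \<phi> x T d \<delta> \<inter> ball x d"
  then have y: "y \<in> X" and xy: "dist x y < d"
    and close: "\<And>t. t \<in> tau_times A \<tau> T \<delta> x \<Longrightarrow> dist (\<phi> t x) (\<phi> t y) < d"
    by (auto simp: tau_ball_def)
  \<comment> \<open>The semiflow law writes \<open>\<phi> t\<close> as \<open>\<phi> (t - s)\<close>
    after \<open>\<phi> s\<close>, with \<open>t - s\<close> in the range of
    \<open>equi\<close>.\<close>
  have step: "dist (\<phi> t x) (\<phi> t y) < \<epsilon>"
    if s: "0 \<le> s" "s \<le> t" "t \<le> s + 1" and d: "dist (\<phi> s x) (\<phi> s y) < d" for s t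
  proof -
    have "\<phi> (r + s) z = \<phi> r (\<phi> s z)" if "z \<in> X" "0 \<le> r" for r z
      using flow that s unfolding semiflow_def by simp
    from this[of _ "t - s"] have "\<phi> t z = \<phi> (t - s) (\<phi> s z)" if "z \<in> X" for z
      using that s by simp
    moreover have "\<phi> s z \<in> X" if "z \<in> X" for z
      using flow that s unfolding semiflow_def by simp
    ultimately show ?thesis
      using equi[of "t - s" "\<phi> s x" "\<phi> s y"] x y s d by auto
  qed
  have start: "dist (\<phi> 0 x) (\<phi> 0 y) < d"
    using flow x y xy by (simp add: semiflow_def)
  have "dist (\<phi> t x) (\<phi> t y) < \<epsilon>" if t: "t \<in> {0..T}" for t
  proof (cases "t \<le> 1")
    case True
    then show ?thesis using step[of 0 t] start t by simp
  next
    case False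
    show ?thesis
    proof (cases "t \<in> tau_times A \<tau> T \<delta> x")
      case True
      \<comment> \<open>Observation gives the bound \<open>d\<close>; \<open>step\<close> with zero
        elapsed time converts it into \<open>\<epsilon>\<close>.\<close>
      then show ?thesis using step[of t t] close[of t] t by simp
    next
      case notin: False
      then obtain j where j: "j \<in> A x" "\<tau> x j \<le> T" "\<tau> x j - \<delta> < t" "t < \<tau> x j + \<delta>"
        using t False unfolding tau_times_def by auto
      \<comment> \<open>Since \<open>t > 1\<close>, the centre exceeds \<open>1 - \<delta>\<close>,
        which is at least \<open>\<delta>\<close>.\<close>
      then have "\<delta> < \<tau> x j" using False \<delta> by linarith
      then have "dist (\<phi> (\<tau> x j - \<delta>) x) (\<phi> (\<tau> x j - \<delta>) y) < d"
        using window_left_end_in_tau_times[where A = A and x = x and \<tau> = \<tau>, OF gap \<delta>(1,2) j(1,2)] close by simp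
      then show ?thesis
        using step[of "\<tau> x j - \<delta>" t] j \<delta> \<open>\<delta> < \<tau> x j\<close> by simp
    qed
  qed
  then show "y \<in> bowen_ball X \<phi> x T \<epsilon>"
    using y by (simp add: bowen_ball_def)
qed

text \<open>Observing fewer times enlarges the balls, so fewer sets are separated. Positivity of
  \<open>\<epsilon>\<close> puts each point in its own Bowen ball, as \<open>separated\<close>
  demands.\<close>

lemma tau_sep_number_le_sep_number:
  assumes "0 < \<epsilon>"
  shows "tau_sep_number X A \<tau> \<phi> T \<epsilon> \<delta> \<le> sep_number X \<phi> T \<epsilon>"
proof -
  have "tau_times A \<tau> T \<delta> x \<subseteq> {0..T}" for x
    by (auto simp: tau_times_def)
  then have "bowen_ball X \<phi> x T \<epsilon> \<subseteq> tau_ball X A \<tau> \<phi> x T \<epsilon> \<delta>" for x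
    unfolding bowen_ball_def tau_ball_def by blast
  moreover have "x \<in> bowen_ball X \<phi> x T \<epsilon>" if "x \<in> X" for x
    using assms that by (simp add: bowen_ball_def)
  ultimately have "tau_separated X A \<tau> \<phi> T \<epsilon> \<delta> E \<Longrightarrow> separated X \<phi> T \<epsilon> E" for E
    unfolding tau_separated_def separated_def by blast
  then show ?thesis
    unfolding tau_sep_number_def sep_number_def by (intro SUP_subset_mono) auto
qed

lemma card_le_card_times_fibre:
  assumes "finite E" "finite K" "f ` E \<subseteq> K"
    and "\<And>k. k \<in> K \<Longrightarrow> card {x \<in> E. f x = k} \<le> m"
  shows "card E \<le> card K * m"
proof -
  have "card E = (\<Sum>k\<in>K. card {x \<in> E. f x = k})"
    using sum.group[OF assms(1-3), of "\<lambda>_. 1 :: nat"] by simp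
  also have "\<dots> \<le> card K * m"
    using sum_bounded_above[of K _ m] assms(4) by simp
  finally show ?thesis .
qed

text \<open>Finitely many balls of radius \<open>d / 2\<close> split a separated set into pieces of
  diameter at most \<open>d\<close> in which any two points are less than \<open>d\<close> apart. On
  such a piece \<open>sub\<close> turns Bowen separation into \<open>\<tau>\<close>-separation, and
  the number of balls does not depend on \<open>T\<close>.\<close>

lemma sep_number_le_tau_sep_number:
  assumes X: "compact X"
    and "0 < d"
    and sub: "\<And>x T. x \<in> X \<Longrightarrow> tau_ball X A \<tau> \<phi> x T d \<delta> \<inter> ball x d \<subseteq> bowen_ball X \<phi> x T \<epsilon>"
  shows "\<exists>N>0. \<forall>T. sep_number X \<phi> T \<epsilon> \<le> enat N * tau_sep_number X A \<tau> \<phi> T d \<delta>"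
proof -
  obtain K where K: "finite K" "X \<subseteq> (\<Union>k\<in>K. ball k (d / 2))"
    using X \<open>0 < d\<close> unfolding compact_eq_totally_bounded by (meson half_gt_zero)
  have "\<forall>x\<in>X. \<exists>k. k \<in> K \<and> x \<in> ball k (d / 2)" using K(2) by blast
  from bchoice[OF this] obtain c where c: "\<And>x. x \<in> X \<Longrightarrow> c x \<in> K \<and> x \<in> ball (c x) (d / 2)"
    by blast
  have fibre: "tau_separated X A \<tau> \<phi> T d \<delta> {x \<in> E. c x = k}" if E: "separated X \<phi> T \<epsilon> E" for T E k
    unfolding tau_separated_def
  proof (intro conjI ballI notI)
    show "{x \<in> E. c x = k} \<subseteq> X"
      using E by (auto simp: separated_def)
    fix x y assume x: "x \<in> {x \<in> E. c x = k}" and y: "y \<in> {x \<in> E. c x = k} - {x}"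
      and b: "y \<in> tau_ball X A \<tau> \<phi> x T d \<delta>"
    have X': "x \<in> X" "y \<in> X" using x y E by (auto simp: separated_def)
    have "dist x y < d"
      using c[OF X'(1)] c[OF X'(2)] x y dist_triangle_half_r[of k x d y] by simp
    then have "y \<in> E \<inter> bowen_ball X \<phi> x T \<epsilon>"
      using sub[OF X'(1), of T] b y by auto
    then show False
      using E x y by (auto simp: separated_def)
  qed
  \<comment> \<open>\<open>Suc\<close> keeps the factor positive even for empty \<open>K\<close>, so
    that its logarithm is finite and its product with \<infinity> is \<infinity>.\<close>
  have "enat (card E) \<le> enat (Suc (card K)) * tau_sep_number X A \<tau> \<phi> T d \<delta>"
    if E: "finite E" "separated X \<phi> T \<epsilon> E" for E T
  proof (cases "tau_sep_number X A \<tau> \<phi> T d \<delta>")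
    case (enat m)
    have "card {x \<in> E. c x = k} \<le> m" for k
    proof -
      have "enat (card {x \<in> E. c x = k}) \<le> tau_sep_number X A \<tau> \<phi> T d \<delta>"
        unfolding tau_sep_number_def using fibre[OF E(2)] E(1) by (intro SUP_upper) simp
      then show ?thesis using enat by simp
    qed
    then have "card E \<le> card K * m"
      using E c K(1) by (intro card_le_card_times_fibre[of E K c]) (auto simp: separated_def)
    then show ?thesis using enat by simp
  qed (simp add: zero_enat_def)
  then have "sep_number X \<phi> T \<epsilon> \<le> enat (Suc (card K)) * tau_sep_number X A \<tau> \<phi> T d \<delta>" for T
    unfolding sep_number_def by (intro SUP_least) auto
  then show ?thesis by (intro exI[of _ "Suc (card K)"]) auto
qed

text \<open>The conventions agree as well: both sides are -\<infinity> for \<open>m = 0\<close> and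
  \<infinity> for \<open>m = \<infinity>\<close>.\<close>

lemma ln_enat_mult_enat:
  assumes "0 < N"
  shows "ln_enat (enat N * m) = ereal (ln (real N)) + ln_enat m"
  using assms by (cases m) (auto simp: ln_enat_def ln_mult zero_enat_def)

text \<open>The factor only adds \<open>ln N / T\<close>, which tends to 0.\<close>

lemma growth_rate_mult_const:
  assumes "0 < N"
  shows "Limsup at_top (\<lambda>T. ereal (1 / T) * ln_enat (enat N * m T))
           \<le> Limsup at_top (\<lambda>T. ereal (1 / T) * ln_enat (m T))"
proof -
  have lim: "((\<lambda>T. ereal (1 / T * ln (real N))) \<longlongrightarrow> ereal 0) at_top"
    by (intro tendsto_ereal tendsto_mult_left_zero tendsto_divide_0[OF tendsto_const]
        filterlim_at_top_imp_at_infinity filterlim_ident)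
  have "ereal (1 / T) * ln_enat (enat N * m T)
      = ereal (1 / T * ln (real N)) + ereal (1 / T) * ln_enat (m T)" if "0 < T" for T
    unfolding ln_enat_mult_enat[OF assms] using that
    by (cases "ln_enat (m T)") (auto simp: field_simps)
  then have "Limsup at_top (\<lambda>T. ereal (1 / T) * ln_enat (enat N * m T))
      = Limsup at_top (\<lambda>T. ereal (1 / T * ln (real N)) + ereal (1 / T) * ln_enat (m T))"
    by (intro Limsup_eq eventually_mono[OF eventually_gt_at_top[of 0]]) auto
  also have "\<dots> \<le> Limsup at_top (\<lambda>T. ereal (1 / T) * ln_enat (m T))"
  \<comment> \<open>The vanishing term is replaced by an arbitrary constant \<open>e > 0\<close>,
    because a finite constant can be pulled out of \<open>Limsup\<close> even when the latter is
    infinite.\<close>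
  proof (rule ereal_le_epsilon2)
    fix e :: real assume "0 < e"
    let ?L = "Limsup at_top (\<lambda>T. ereal (1 / T) * ln_enat (m T))"
    have "\<forall>\<^sub>F T in at_top. ereal (1 / T * ln (real N)) < ereal e"
      using lim \<open>0 < e\<close> by (intro order_tendstoD(2)[OF lim]) simp
    then have "Limsup at_top (\<lambda>T. ereal (1 / T * ln (real N)) + ereal (1 / T) * ln_enat (m T))
      \<le> Limsup at_top (\<lambda>T. ereal (1 / T) * ln_enat (m T) + ereal e)"
      by (intro Limsup_mono) (elim eventually_mono, subst add.commute,
          intro add_left_mono less_imp_le)
    also have "\<dots> = ?L + ereal e"
      by (rule Limsup_add_ereal_right) auto
    finally show "Limsup at_top (\<lambda>T. ereal (1 / T * ln (real N)) + ereal (1 / T) * ln_enat (m T))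
      \<le> ?L + ereal e" .
  qed
  finally show ?thesis .
qed

text \<open>By monotonicity the left side bounds \<open>tau_entropy_delta\<close> from below at
  every smaller \<open>\<delta>'\<close>, hence also its limit.\<close>

lemma tau_growth_le_tau_top_entropy:
  assumes "0 < \<epsilon>" "0 < \<delta>"
  shows "tau_growth X A \<tau> \<psi> \<epsilon> \<delta> \<le> tau_top_entropy X A \<tau> \<psi>"
proof -
  have "tau_growth X A \<tau> \<psi> \<epsilon> \<delta> \<le> tau_entropy_delta X A \<tau> \<psi> \<delta>'" if "\<delta>' < \<delta>" for \<delta>'
    unfolding tau_entropy_delta_eq_SUP using assms(1) that
    by (intro SUP_upper2[where i = \<epsilon>] tau_growth_antimono) auto
  then show ?thesis
    using eventually_at_right_real[OF assms(2)]
    by (intro tendsto_lowerbound[OF tendsto_tau_top_entropy]) (auto elim: eventually_mono)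
qed

theorem theorem1:
  fixes X Z :: "'a::metric_space set"
    and \<phi> :: "real \<Rightarrow> 'a \<Rightarrow> 'a"
    and A :: "'a \<Rightarrow> nat set" and \<tau> :: "'a \<Rightarrow> nat \<Rightarrow> real"
  assumes "compact X"
    and "continuous_semiflow X \<phi>"
    and "Z \<subseteq> X"
    and "admissible X \<phi> Z A \<tau>"
  shows "tau_top_entropy X A \<tau> \<phi> = top_entropy X \<phi>"
proof (rule antisym)
  have le: "tau_growth X A \<tau> \<phi> \<epsilon> \<delta> \<le> growth X \<phi> \<epsilon>" if "0 < \<epsilon>" for \<epsilon> \<delta>
    unfolding tau_growth_def growth_def
    by (intro growth_rate_mono tau_sep_number_le_sep_number that)
  have "tau_entropy_delta X A \<tau> \<phi> \<delta> \<le> top_entropy X \<phi>" for \<delta>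
  proof (rule tendsto_le[OF _ tendsto_top_entropy tendsto_tau_entropy_delta])
    show "\<forall>\<^sub>F \<epsilon> in at_right 0. tau_growth X A \<tau> \<phi> \<epsilon> \<delta> \<le> growth X \<phi> \<epsilon>"
      using eventually_at_right_less by eventually_elim (rule le)
  qed simp
  then show "tau_top_entropy X A \<tau> \<phi> \<le> top_entropy X \<phi>"
    by (intro tendsto_upperbound[OF tendsto_tau_top_entropy]) auto
next
  have flow: "semiflow X \<phi>"
    using assms(2) by (simp add: continuous_semiflow_def)
  obtain \<eta> where "0 < \<eta>"
    and step: "\<And>x n. \<lbrakk>x \<in> X; n \<in> A x; n + 1 \<in> A x\<rbrakk> \<Longrightarrow> \<tau> x (n + 1) - \<tau> x n \<ge> \<eta>"
    and seq: "time_sequences X A \<tau>"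
    using assms(4) unfolding admissible_def by blast
  have gap: "\<tau> x j - \<tau> x i \<ge> \<eta>" if "x \<in> X" "i \<in> A x" "j \<in> A x" "i < j" for x i j
    using index_set_gap[of "A x" "\<tau> x" \<eta> i j] step seq that by (simp add: time_sequences_def)
  \<comment> \<open>The largest value for which the open windows are disjoint and no longer than the
    time horizon 1 of equicontinuity; it is fixed before \<open>\<epsilon>\<close>.\<close>
  define \<delta> where "\<delta> = min \<eta> 1 / 2"
  have \<delta>: "0 < \<delta>" "2 * \<delta> \<le> \<eta>" "2 * \<delta> \<le> 1"
    using \<open>0 < \<eta>\<close> by (auto simp: \<delta>_def)
  have "growth X \<phi> \<epsilon> \<le> tau_top_entropy X A \<tau> \<phi>" if "0 < \<epsilon>" for \<epsilon>
  proof -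
    obtain d where "0 < d"
      and d: "\<And>t x y. \<lbrakk>t \<in> {0..1}; x \<in> X; y \<in> X; dist x y < d\<rbrakk> \<Longrightarrow> dist (\<phi> t x) (\<phi> t y) < \<epsilon>"
      using semiflow_equicontinuous[OF assms(1,2) \<open>0 < \<epsilon>\<close>, of 1] by blast
    have "tau_ball X A \<tau> \<phi> x T d \<delta> \<inter> ball x d \<subseteq> bowen_ball X \<phi> x T \<epsilon>" if "x \<in> X" for x T
      using flow gap[OF that] \<delta> d that by (rule tau_ball_subset_bowen_ball)
    from sep_number_le_tau_sep_number[OF assms(1) \<open>0 < d\<close> this] obtain N where "0 < N"
      and N: "\<And>T. sep_number X \<phi> T \<epsilon> \<le> enat N * tau_sep_number X A \<tau> \<phi> T d \<delta>"
      by blast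
    \<comment> \<open>The scale passes from \<open>\<epsilon>\<close> to \<open>d\<close>; this
      costs nothing, as the \<tau>-entropy dominates \<open>tau_growth\<close> at every positive
      scale.\<close>
    have "growth X \<phi> \<epsilon> \<le> tau_growth X A \<tau> \<phi> d \<delta>"
      unfolding growth_def tau_growth_def
      using growth_rate_mono[OF N] growth_rate_mult_const[OF \<open>0 < N\<close>] by (rule order_trans)
    also have "\<dots> \<le> tau_top_entropy X A \<tau> \<phi>"
      using \<open>0 < d\<close> \<delta>(1) by (rule tau_growth_le_tau_top_entropy)
    finally show ?thesis .
  qed
  then show "top_entropy X \<phi> \<le> tau_top_entropy X A \<tau> \<phi>"
    by (intro tendsto_upperbound[OF tendsto_top_entropy] eventually_mono[OF eventually_at_right_less])
      auto
qed

end
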